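(* Let $\mathcal{K}^{AB}\subseteq\mathbb{C}_h^{nm\times nm}$ be an SDG satisfying epistemic independence of $A$ and $B$, and let $\mathrm{marg}_A(\mathcal{K}^{AB})$ and $\mathrm{marg}_B(\mathcal{K}^{AB})$ be maximal SDGs with duals $\{\rho^A\}$ and $\{\rho^B\}$ respectively, such that $\mathrm{Tr}(\Pi_i^A\rho^A\Pi_i^A)>0$ for every projector $\Pi_i^A$ of every projection measurement $\Pi^A$ on $\mathbb{C}^n$, and $\mathrm{Tr}(\Pi_i^B\rho^B\Pi_i^B)>0$ for every projector $\Pi_i^B$ of every projection measurement $\Pi^B$ on $\mathbb{C}^m$. Then the dual of $\mathcal{K}^{AB}$ is $$\mathcal{M}^{AB}=\{\rho^A\otimes\rho^B\},$$ i.e. $\mathcal{K}^{AB}$ is maximal with dual density matrix $\rho^A\otimes\rho^B$.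
   Context: $\mathbb{C}_h^{k\times k}$ is the real vector space of $k\times k$ complex Hermitian matrices, with inner product $G\cdot R=\mathrm{Tr}(G^\dagger R)$. $G\gneq 0$ means $G$ is positive semi-definite and $G\ne 0$; $G>0$ means positive definite. $\mathcal{D}_h^{k\times k}$ is the set of $k\times k$ density matrices (positive semi-definite, trace one). $I_k$ is the $k\times k$ identity. A set $\mathcal{K}\subseteq\mathbb{C}_h^{k\times k}$ is a coherent set of strictly desirable gambles (SDG) if: (S1) it is closed under addition and under multiplication by reals $\nu>0$, and $0\notin\mathcal{K}$; (S2) every $G\gneq 0$ belongs to $\mathcal{K}$; (S3) if $G\in\mathcal{K}$ then either $G\gneq 0$ or $G-\Delta\in\mathcal{K}$ for some $\Delta>0$. It is maximal if no other SDG includes it. The dual of $\mathcal{K}$ is $\{\rho\in\mathcal{D}_h^{k\times k}\mid G\cdot\rho\ge 0\ \forall G\in\mathcal{K}\}$. A projection measurement on $\mathbb{C}^k$ is a family of $k$ nonzero (hence rank-one) Hermitian matrices $\Pi_1,\dots,\Pi_k$ with $\Pi_i^2=\Pi_i$, $\Pi_i\Pi_j=0$ for $i\neq j$, $\sum_i\Pi_i=I_k$. For an SDG $\mathcal{K}^{AB}\subseteq\mathbb{C}_h^{nm\times nm}$ (composite system of $A$ with dimension $n$ and $B$ with dimension $m$): $\mathrm{marg}_A(\mathcal{K}^{AB})=\{G\in\mathbb{C}_h^{n\times n}\mid G\otimes I_m\in\mathcal{K}^{AB}\}$ and $\mathrm{marg}_B(\mathcal{K}^{AB})=\{G\in\mathbb{C}_h^{m\times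 m}\mid I_n\otimes G\in\mathcal{K}^{AB}\}$ (same definition for any subset of $\mathbb{C}_h^{nm\times nm}$). $\mathcal{K}^{AB}$ satisfies epistemic irrelevance of $A$ to $B$ if, for each projection measurement $\Pi^B$ on $\mathbb{C}^m$ and each projector $\Pi_i^B$ in it, $\mathrm{marg}_A(\mathcal{K}^{AB})=\mathrm{marg}_A(\mathcal{K}^{AB}_B)$, where $\mathcal{K}^{AB}_B=\{H\in\mathbb{C}_h^{nm\times nm}\mid H\gneq 0\ \text{or}\ (I_n\otimes\Pi_i^B)H(I_n\otimes\Pi_i^B)\in\mathcal{K}^{AB}\}$. Epistemic irrelevance of $B$ to $A$ is defined by exchanging the roles of $A$ and $B$: for each projector $\Pi_i^A$ of each projection measurement on $\mathbb{C}^n$, $\mathrm{marg}_B(\mathcal{K}^{AB})=\mathrm{marg}_B(\mathcal{K}^{AB}_A)$ with $\mathcal{K}^{AB}_A=\{H\mid H\gneq 0\ \text{or}\ (\Pi_i^A\otimes I_m)H(\Pi_i^A\otimes I_m)\in\mathcal{K}^{AB}\}$. $\mathcal{K}^{AB}$ satisfies epistemic independence of $A$ and $B$ if it satisfies both irrelevances. *)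

theory Defs
  imports "HOL-Analysis.Analysis"
begin

text \<open>
  A \<open>k \<times> k\<close> complex matrix is a \<^typ>\<open>complex ^ 'k ^ 'k\<close> with \<open>CARD('k) = k\<close>. The composite
  of a system of dimension \<open>CARD('a)\<close> and one of dimension \<open>CARD('b)\<close> is indexed by the product
  type \<^typ>\<open>'a \<times> 'b\<close>.
\<close>

type_synonym 'k cmat = "complex ^ 'k ^ 'k"

definition dagger :: "'k::finite cmat \<Rightarrow> 'k cmat" where
  "dagger G = (\<chi> i j. cnj (G $ j $ i))"

definition hermitian :: "'k::finite cmat \<Rightarrow> bool" where
  "hermitian G \<longleftrightarrow> dagger G = G"

text \<open>
  For Hermitian matrices the trace below is a real number (\<open>trace_dagger_mult_real\<close>), so taking
  the real part only changes the type.
\<close>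

definition mat_inner :: "'k::finite cmat \<Rightarrow> 'k cmat \<Rightarrow> real" where
  "mat_inner G R = Re (trace (dagger G ** R))"

lemma trace_dagger_mult_real:
  assumes "hermitian G" "hermitian R"
  shows "trace (dagger G ** R) \<in> \<real>"
proof -
  have G: "cnj (G $ i $ j) = G $ j $ i" and R: "cnj (R $ i $ j) = R $ j $ i" for i j
    using assms unfolding hermitian_def dagger_def by (metis vec_lambda_beta)+
  have "cnj (trace (dagger G ** R)) = (\<Sum>i\<in>UNIV. \<Sum>j\<in>UNIV. G $ j $ i * R $ i $ j)"
    by (simp add: trace_def matrix_matrix_mult_def dagger_def R)
  also have "\<dots> = (\<Sum>i\<in>UNIV. \<Sum>j\<in>UNIV. G $ i $ j * R $ j $ i)"
    by (rule sum.swap)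
  also have "\<dots> = trace (dagger G ** R)"
    by (simp add: trace_def matrix_matrix_mult_def dagger_def G)
  finally show ?thesis
    by (simp add: Reals_cnj_iff)
qed

text \<open>The real part of \<open>x\<^sup>\<dagger> G x\<close>, which is real whenever \<open>G\<close> is Hermitian.\<close>

definition quad_form :: "'k::finite cmat \<Rightarrow> complex ^ 'k \<Rightarrow> real" where
  "quad_form G x = Re (\<Sum>i\<in>UNIV. cnj (x $ i) * (G *v x) $ i)"

definition pos_semidef :: "'k::finite cmat \<Rightarrow> bool" where
  "pos_semidef G \<longleftrightarrow> hermitian G \<and> (\<forall>x. 0 \<le> quad_form G x)"

definition pos_def :: "'k::finite cmat \<Rightarrow> bool" where
  "pos_def G \<longleftrightarrow> hermitian G \<and> (\<forall>x. x \<noteq> 0 \<longrightarrow> 0 < quad_form G x)"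

definition psd_nonzero :: "'k::finite cmat \<Rightarrow> bool" where
  "psd_nonzero G \<longleftrightarrow> pos_semidef G \<and> G \<noteq> 0"

definition density_matrices :: "'k::finite cmat set" where
  "density_matrices = {\<rho>. pos_semidef \<rho> \<and> trace \<rho> = 1}"

text \<open>
  The last condition is the openness requirement that makes a coherent set of gambles a set of
  \<^emph>\<open>strictly\<close> desirable gambles.
\<close>

definition sdg :: "'k::finite cmat set \<Rightarrow> bool" where
  "sdg K \<longleftrightarrow>
     (\<forall>G\<in>K. hermitian G) \<and>
     (\<forall>G\<in>K. \<forall>H\<in>K. G + H \<in> K) \<and>
     (\<forall>G\<in>K. \<forall>\<nu>::real. 0 < \<nu> \<longrightarrow> \<nu> *\<^sub>R G \<in> K) \<and>
     0 \<notin> K \<and>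
     (\<forall>G. psd_nonzero G \<longrightarrow> G \<in> K) \<and>
     (\<forall>G\<in>K. psd_nonzero G \<or> (\<exists>\<Delta>. pos_def \<Delta> \<and> G - \<Delta> \<in> K))"

definition maximal_sdg :: "'k::finite cmat set \<Rightarrow> bool" where
  "maximal_sdg K \<longleftrightarrow> sdg K \<and> (\<forall>K'. sdg K' \<and> K \<subseteq> K' \<longrightarrow> K' = K)"

definition sdg_dual :: "'k::finite cmat set \<Rightarrow> 'k cmat set" where
  "sdg_dual K = {\<rho> \<in> density_matrices. \<forall>G\<in>K. 0 \<le> mat_inner G \<rho>}"

text \<open>
  The family has exactly \<open>k\<close> members because it is indexed by the type that indexes the rows.
\<close>

definition projection_measurement :: "('k::finite \<Rightarrow> 'k cmat) \<Rightarrow> bool" where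
  "projection_measurement P \<longleftrightarrow>
     (\<forall>i. P i \<noteq> 0 \<and> hermitian (P i) \<and> P i ** P i = P i) \<and>
     (\<forall>i j. i \<noteq> j \<longrightarrow> P i ** P j = 0) \<and>
     (\<Sum>i\<in>UNIV. P i) = mat 1"

definition kron :: "'a::finite cmat \<Rightarrow> 'b::finite cmat \<Rightarrow> ('a \<times> 'b) cmat"  (infixl "\<otimes>" 75) where
  "A \<otimes> B = (\<chi> p q. A $ fst p $ fst q * B $ snd p $ snd q)"

definition marg_A :: "('a::finite \<times> 'b::finite) cmat set \<Rightarrow> 'a cmat set" where
  "marg_A K = {G. hermitian G \<and> G \<otimes> mat 1 \<in> K}"

definition marg_B :: "('a::finite \<times> 'b::finite) cmat set \<Rightarrow> 'b cmat set" where
  "marg_B K = {G. hermitian G \<and> mat 1 \<otimes> G \<in> K}"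

text \<open>The gambles desirable after observing the projector \<open>P\<close> on \<open>B\<close>, respectively on \<open>A\<close>.\<close>

definition cond_B :: "('a::finite \<times> 'b::finite) cmat set \<Rightarrow> 'b cmat \<Rightarrow> ('a \<times> 'b) cmat set" where
  "cond_B K P =
     {H. hermitian H \<and> (psd_nonzero H \<or> (mat 1 \<otimes> P) ** H ** (mat 1 \<otimes> P) \<in> K)}"

definition cond_A :: "('a::finite \<times> 'b::finite) cmat set \<Rightarrow> 'a cmat \<Rightarrow> ('a \<times> 'b) cmat set" where
  "cond_A K P =
     {H. hermitian H \<and> (psd_nonzero H \<or> (P \<otimes> mat 1) ** H ** (P \<otimes> mat 1) \<in> K)}"

definition irrelevance_A_to_B :: "('a::finite \<times> 'b::finite) cmat set \<Rightarrow> bool" where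
  "irrelevance_A_to_B K \<longleftrightarrow>
     (\<forall>P. projection_measurement P \<longrightarrow> (\<forall>i. marg_A K = marg_A (cond_B K (P i))))"

definition irrelevance_B_to_A :: "('a::finite \<times> 'b::finite) cmat set \<Rightarrow> bool" where
  "irrelevance_B_to_A K \<longleftrightarrow>
     (\<forall>P. projection_measurement P \<longrightarrow> (\<forall>i. marg_B K = marg_B (cond_A K (P i))))"

definition epistemic_independence :: "('a::finite \<times> 'b::finite) cmat set \<Rightarrow> bool" where
  "epistemic_independence K \<longleftrightarrow> irrelevance_A_to_B K \<and> irrelevance_B_to_A K"

end

theory Submission
  imports Defs
begin

text \<open>
  By separation, a Hermitian \<open>G \<notin> K\<close> satisfies \<open>G \<cdot> \<rho> \<le> 0\<close> for some \<open>\<rho>\<close> in the dual of \<open>K\<close>, while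
  openness gives \<open>G \<cdot> \<rho> > 0\<close> for all \<open>G \<in> K\<close> that are not positive semi-definite. Hence duals are
  nonempty and a singleton dual implies maximality.

  Let \<open>\<tau>\<close> be in the dual of \<open>K\<close>. Irrelevance makes \<open>G \<mapsto> (G \<otimes> \<Pi>) \<cdot> \<tau>\<close> nonnegative on the marginal on
  \<open>A\<close> for every projector \<open>\<Pi>\<close> of a measurement on \<open>B\<close>, so it is a multiple of \<open>\<rho>\<^sup>A\<close>; evaluating at
  \<open>G = I\<close> shows that the factor is \<open>\<Pi> \<cdot> \<rho>\<^sup>B\<close>. Such projectors span the Hermitian matrices, so
  \<open>\<tau> = \<rho>\<^sup>A \<otimes> \<rho>\<^sup>B\<close>.
\<close>

section \<open>Hermitian matrices, quadratic forms and rank-one matrices\<close>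

lemma hermitian_iff: "hermitian G \<longleftrightarrow> (\<forall>i j. cnj (G $ j $ i) = G $ i $ j)"
  by (auto simp: hermitian_def dagger_def vec_eq_iff)

lemma inner_complex_eq_Re: "inner z w = Re (cnj z * w)"
  by (simp add: inner_complex_def)

lemma inner_cmat: "inner G R = (\<Sum>i\<in>UNIV. \<Sum>j\<in>UNIV. Re (cnj (G $ i $ j) * R $ i $ j))"
  for G R :: "'k::finite cmat"
  by (simp only: inner_vec_def inner_complex_eq_Re)

text \<open>Identifies the trace form with the type-class inner product of nested vectors, which
  makes Cauchy-Schwarz and hyperplane separation available.\<close>

lemma mat_inner_eq_inner: "mat_inner G R = inner G R"
proof -
  have "mat_inner G R = (\<Sum>i\<in>UNIV. \<Sum>j\<in>UNIV. Re (cnj (G $ j $ i) * R $ j $ i))"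
    by (simp add: mat_inner_def trace_def matrix_matrix_mult_def dagger_def)
  also have "\<dots> = (\<Sum>i\<in>UNIV. \<Sum>j\<in>UNIV. Re (cnj (G $ i $ j) * R $ i $ j))"
    by (rule sum.swap)
  finally show ?thesis
    by (simp only: inner_cmat)
qed

lemma quad_form_eq_inner: "quad_form G x = inner x (G *v x)"
  by (simp only: quad_form_def inner_vec_def inner_complex_eq_Re Re_sum)

lemma inner_mat_1: "inner (mat 1) G = Re (trace G)" for G :: "'k::finite cmat"
proof -
  have "inner (mat 1) G = (\<Sum>i\<in>UNIV. \<Sum>j\<in>UNIV. if i = j then Re (G $ i $ j) else 0)"
    unfolding inner_cmat by (intro sum.cong refl) (auto simp: mat_def)
  then show ?thesis
    by (simp add: trace_def)
qed

lemma dagger_dagger: "dagger (dagger G) = G"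
  by (simp add: dagger_def vec_eq_iff)

lemma inner_dagger_dagger: "inner (dagger G) (dagger R) = inner G R"
proof -
  have "inner (dagger G) (dagger R) = (\<Sum>i\<in>UNIV. \<Sum>j\<in>UNIV. Re (cnj (G $ j $ i) * R $ j $ i))"
    by (simp add: inner_cmat dagger_def)
  also have "\<dots> = inner G R"
    unfolding inner_cmat by (rule sum.swap)
  finally show ?thesis .
qed

lemma dagger_add: "dagger (G + R) = dagger G + dagger R"
  and dagger_diff: "dagger (G - R) = dagger G - dagger R"
  and dagger_scaleR: "dagger (c *\<^sub>R G) = c *\<^sub>R dagger G"
  by (simp_all add: dagger_def vec_eq_iff)

lemma hermitian_diff: "hermitian G \<Longrightarrow> hermitian R \<Longrightarrow> hermitian (G - R)"
  and hermitian_scaleR: "hermitian G \<Longrightarrow> hermitian (c *\<^sub>R G)"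
  by (simp_all add: hermitian_def dagger_diff dagger_scaleR)

lemma hermitian_mat_1: "hermitian (mat 1)"
  by (auto simp: hermitian_iff mat_def)

lemma scaleR_matrix_vector: "(c *\<^sub>R G) *v x = c *\<^sub>R (G *v x)" for G :: "'k::finite cmat"
  by (simp add: matrix_vector_mult_def vec_eq_iff scaleR_sum_right)

lemma matrix_vector_scaleR: "G *v (c *\<^sub>R x) = c *\<^sub>R (G *v x)" for G :: "'k::finite cmat"
  by (simp add: matrix_vector_mult_def vec_eq_iff scaleR_sum_right)

lemma quad_form_diff: "quad_form (G - R) x = quad_form G x - quad_form R x"
  by (simp add: quad_form_eq_inner matrix_vector_mult_diff_rdistrib inner_diff_right)

lemma quad_form_scaleR: "quad_form (c *\<^sub>R G) x = c * quad_form G x"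
  by (simp add: quad_form_eq_inner scaleR_matrix_vector)

lemma quad_form_mat_1: "quad_form (mat 1) x = (norm x)\<^sup>2"
  by (simp add: quad_form_eq_inner power2_norm_eq_inner)

lemma quad_form_scaleR_vector: "quad_form G (c *\<^sub>R x) = c\<^sup>2 * quad_form G x"
  by (simp add: quad_form_eq_inner matrix_vector_scaleR power2_eq_square)

lemma continuous_on_quad_form: "continuous_on S (quad_form G)"
  unfolding quad_form_def matrix_vector_mult_def by (intro continuous_intros)

definition rank_one :: "complex ^ 'k \<Rightarrow> 'k::finite cmat" where
  "rank_one x = (\<chi> i j. x $ i * cnj (x $ j))"

lemma hermitian_rank_one: "hermitian (rank_one x)"
  by (simp add: hermitian_iff rank_one_def)

text \<open>Shows that a Hermitian functional nonnegative on rank-one matrices is positive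
  semi-definite, and turns the pairing with a projector into a quadratic form.\<close>

lemma inner_rank_one: "inner (rank_one x) G = quad_form G x"
  by (simp add: inner_cmat rank_one_def quad_form_def matrix_vector_mult_def sum_distrib_left
      algebra_simps)

lemma quad_form_rank_one: "quad_form (rank_one x) y = (cmod (\<Sum>i\<in>UNIV. cnj (x $ i) * y $ i))\<^sup>2"
proof -
  let ?s = "\<Sum>i\<in>UNIV. cnj (x $ i) * y $ i"
  have "(\<Sum>i\<in>UNIV. cnj (y $ i) * (rank_one x *v y) $ i) = (\<Sum>i\<in>UNIV. cnj (y $ i) * x $ i) * ?s"
    by (simp add: rank_one_def matrix_vector_mult_def sum_product sum_distrib_left algebra_simps)
      (rule sum.swap)
  also have "\<dots> = cnj ?s * ?s"
    by (simp add: mult.commute)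
  also have "\<dots> = of_real ((cmod ?s)\<^sup>2)"
    by (subst mult.commute) (rule complex_norm_square[symmetric])
  finally show ?thesis
    by (simp only: quad_form_def Re_complex_of_real)
qed

lemma rank_one_eq_0_iff: "rank_one x = 0 \<longleftrightarrow> x = 0"
  by (auto simp: rank_one_def vec_eq_iff)

lemma psd_nonzero_rank_one: "x \<noteq> 0 \<Longrightarrow> psd_nonzero (rank_one x)"
  by (simp add: psd_nonzero_def pos_semidef_def hermitian_rank_one quad_form_rank_one
      rank_one_eq_0_iff)

section \<open>Comparison with multiples of the identity\<close>

text \<open>Boundedness of \<open>H\<close> and Cauchy-Schwarz give
  \<open>quad_form H x \<le> B * (norm x)\<^sup>2\<close>; the choice \<open>t = B + 1\<close>
  leaves room for a strict inequality, so the difference is nonzero.\<close>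

lemma exists_scaled_identity_dominating:
  assumes "hermitian (H :: 'k::finite cmat)"
  obtains t where "0 < t" "psd_nonzero (t *\<^sub>R mat 1 - H)"
proof -
  have "bounded_linear ((*v) H)"
    by (rule matrix_vector_mul_bounded_linear)
  then obtain B where B: "0 < B" "\<And>x. norm (H *v x) \<le> norm x * B"
    using bounded_linear.pos_bounded by blast
  have q: "B + 1 > 0" "quad_form H x \<le> B * (norm x)\<^sup>2" for x
    using norm_cauchy_schwarz[of x "H *v x"] mult_left_mono[OF B(2)[of x], of "norm x"] B(1)
    by (auto simp: quad_form_eq_inner power2_eq_square algebra_simps)
  have pos: "0 < quad_form ((B + 1) *\<^sub>R mat 1 - H) x" if "x \<noteq> 0" for x
  proof -
    have "quad_form ((B + 1) *\<^sub>R mat 1 - H) x = B * (norm x)\<^sup>2 + (norm x)\<^sup>2 - quad_form H x"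
      by (simp only: quad_form_diff quad_form_scaleR quad_form_mat_1 distrib_right mult_1)
    moreover have "0 < (norm x)\<^sup>2"
      using that by simp
    ultimately show ?thesis
      using q(2)[of x] by linarith
  qed
  have "0 \<le> quad_form ((B + 1) *\<^sub>R mat 1 - H) x" for x
    using pos[of x] by (cases "x = 0") (auto simp: quad_form_eq_inner)
  moreover have "(B + 1) *\<^sub>R mat 1 - H \<noteq> 0"
    using pos[of "axis undefined 1"] by (auto simp: quad_form_eq_inner axis_eq_0_iff)
  ultimately show thesis
    using that[of "B + 1"] q(1) assms
    by (simp add: psd_nonzero_def pos_semidef_def hermitian_diff hermitian_scaleR hermitian_mat_1)
qed

text \<open>The quadratic form attains a positive minimum \<open>e\<close> on the compact unit
  sphere, and homogeneity of degree two carries the bound to all vectors. This gives openness a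
  quantitative form.\<close>

lemma pos_def_dominates_scaled_identity:
  assumes "pos_def (D :: 'k::finite cmat)"
  obtains e where "0 < e" "pos_semidef (D - e *\<^sub>R mat 1)"
proof -
  have "(axis undefined 1 :: complex ^ 'k) \<in> sphere 0 1"
    by simp
  then obtain u :: "complex ^ 'k" where u: "u \<in> sphere 0 1"
    "\<And>y. y \<in> sphere 0 1 \<Longrightarrow> quad_form D u \<le> quad_form D y"
    using continuous_attains_inf[OF compact_sphere _ continuous_on_quad_form[of _ D]] by blast
  let ?e = "quad_form D u"
  have "?e * (norm x)\<^sup>2 \<le> quad_form D x" for x
  proof (cases "x = 0")
    case True
    then show ?thesis by (simp add: quad_form_eq_inner)
  next
    case False
    have "?e \<le> quad_form D ((1 / norm x) *\<^sub>R x)"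
      using False by (intro u(2)) simp
    then show ?thesis
      using False unfolding quad_form_scaleR_vector by (simp add: field_simps)
  qed
  then have "pos_semidef (D - ?e *\<^sub>R mat 1)"
    using assms by (simp add: pos_semidef_def pos_def_def hermitian_diff hermitian_scaleR
        hermitian_mat_1 quad_form_diff quad_form_scaleR quad_form_mat_1)
  moreover have "u \<noteq> 0"
    using u(1) by auto
  then have "0 < ?e"
    using assms by (auto simp: pos_def_def)
  ultimately show thesis
    using that by blast
qed

section \<open>Nonnegative functionals on an SDG and its dual\<close>

lemma sdgD:
  assumes "sdg K"
  shows "G \<in> K \<Longrightarrow> hermitian G"
    and "G \<in> K \<Longrightarrow> H \<in> K \<Longrightarrow> G + H \<in> K"
    and "G \<in> K \<Longrightarrow> 0 < c \<Longrightarrow> c *\<^sub>R G \<in> K"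
    and "0 \<notin> K"
    and "psd_nonzero G \<Longrightarrow> G \<in> K"
    and "G \<in> K \<Longrightarrow> psd_nonzero G \<or> (\<exists>\<Delta>. pos_def \<Delta> \<and> G - \<Delta> \<in> K)"
  using assms unfolding sdg_def by blast+

lemma sdg_nonneg_on_psd:
  assumes "sdg K" "\<And>G. G \<in> K \<Longrightarrow> 0 \<le> inner G \<sigma>" "pos_semidef G"
  shows "0 \<le> inner G \<sigma>"
  using assms sdgD(5)[OF assms(1), of G] by (cases "G = 0") (auto simp: psd_nonzero_def)

text \<open>For large \<open>t\<close> the matrix \<open>t *\<^sub>R mat 1 - \<sigma>\<close> lies
  in \<open>K\<close>; pairing it with \<open>\<sigma>\<close> itself bounds
  \<open>inner \<sigma> \<sigma>\<close> by \<open>t\<close> times the trace. Hence division by the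
  trace is possible.\<close>

lemma nonneg_functional_trace_pos:
  assumes "sdg K" "\<And>G. G \<in> K \<Longrightarrow> 0 \<le> inner G \<sigma>" "hermitian \<sigma>" "\<sigma> \<noteq> 0"
  shows "0 < Re (trace \<sigma>)"
proof -
  obtain t where t: "0 < t" "psd_nonzero (t *\<^sub>R mat 1 - \<sigma>)"
    using exists_scaled_identity_dominating assms(3) by blast
  then have "0 \<le> inner (t *\<^sub>R mat 1 - \<sigma>) \<sigma>"
    using assms(1,2) sdgD(5) by blast
  then have "inner \<sigma> \<sigma> \<le> t * Re (trace \<sigma>)"
    by (simp add: inner_diff_left inner_mat_1)
  then have "0 < t * Re (trace \<sigma>)"
    using assms(4) by (metis inner_gt_zero_iff less_le_trans)
  then show ?thesis
    using t(1) by (simp add: zero_less_mult_iff)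
qed

lemma hermitian_trace_eq: "hermitian G \<Longrightarrow> trace G = of_real (Re (trace G))"
proof -
  assume "hermitian G"
  then have "cnj (trace G) = trace G"
    by (simp add: trace_def hermitian_iff)
  then show ?thesis
    by (metis Reals_cnj_iff of_real_Re)
qed

lemma trace_scaleR: "trace (c *\<^sub>R G) = c *\<^sub>R trace G" for G :: "'k::finite cmat"
  by (simp add: trace_def scaleR_sum_right)

lemma nonneg_functional_normalized_in_dual:
  assumes "sdg K" "\<And>G. G \<in> K \<Longrightarrow> 0 \<le> inner G \<sigma>" "hermitian \<sigma>" "\<sigma> \<noteq> 0"
  shows "(1 / Re (trace \<sigma>)) *\<^sub>R \<sigma> \<in> sdg_dual K"
proof -
  have pos: "0 < Re (trace \<sigma>)"
    by (rule nonneg_functional_trace_pos[OF assms])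
  have "0 \<le> quad_form \<sigma> x" for x
  proof (cases "x = 0")
    case False
    then show ?thesis
      using assms(2)[OF sdgD(5)[OF assms(1) psd_nonzero_rank_one]] by (simp add: inner_rank_one)
  qed (simp add: quad_form_eq_inner)
  moreover have "trace ((1 / Re (trace \<sigma>)) *\<^sub>R \<sigma>) = 1"
    using hermitian_trace_eq[OF assms(3)] pos unfolding trace_scaleR
    by (simp add: complex_eq_iff)
  ultimately show ?thesis
    using pos assms(2,3)
    by (simp add: sdg_dual_def density_matrices_def pos_semidef_def mat_inner_eq_inner
        hermitian_scaleR quad_form_scaleR)
qed

lemma sdg_dual_hermitian: "\<rho> \<in> sdg_dual K \<Longrightarrow> hermitian \<rho>"
  and sdg_dual_trace: "\<rho> \<in> sdg_dual K \<Longrightarrow> trace \<rho> = 1"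
  and sdg_dual_nonneg: "\<rho> \<in> sdg_dual K \<Longrightarrow> G \<in> K \<Longrightarrow> 0 \<le> inner G \<rho>"
  by (auto simp: sdg_dual_def density_matrices_def pos_semidef_def mat_inner_eq_inner)

text \<open>Normalising a nonzero functional lands in the dual, where only \<open>\<rho>\<close> is
  available. The states of the marginals are identified through this fact.\<close>

lemma nonneg_functional_multiple_of_dual:
  assumes "sdg K" "sdg_dual K = {\<rho>}" "\<And>G. G \<in> K \<Longrightarrow> 0 \<le> inner G \<sigma>" "hermitian \<sigma>"
  shows "\<sigma> = Re (trace \<sigma>) *\<^sub>R \<rho>"
proof (cases "\<sigma> = 0")
  case False
  have "(1 / Re (trace \<sigma>)) *\<^sub>R \<sigma> = \<rho>"
    using nonneg_functional_normalized_in_dual[OF assms(1,3,4) False] assms(2) by simp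
  then show ?thesis
    using nonneg_functional_trace_pos[OF assms(1,3,4) False]
    by (auto simp flip: \<open>_ = \<rho>\<close>)
qed (simp add: trace_def)

section \<open>Separation, openness and maximality\<close>

text \<open>Separates \<open>G\<close> from a convex cone by a hyperplane; invariance of the cone
  under positive scaling lets the level be moved to zero, and dividing by the trace gives a
  state.\<close>

lemma exists_dual_separating:
  assumes "sdg K" "hermitian G" "G \<notin> K"
  obtains \<rho> where "\<rho> \<in> sdg_dual K" "inner G \<rho> \<le> 0"
proof -
  \<comment> \<open>Adding all anti-Hermitian matrices to \<open>K\<close> forces the separating functional to be Hermitian.\<close>
  define S where "S = {M. M + dagger M \<in> K}"
  have scale: "c *\<^sub>R x \<in> S" if "x \<in> S" "0 < c" for c x
    using that sdgD(3)[OF assms(1), of "x + dagger x" c]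
    by (simp add: S_def dagger_scaleR scaleR_add_right)
  have add: "x + y \<in> S" if "x \<in> S" "y \<in> S" for x y
    using that sdgD(2)[OF assms(1), of "x + dagger x" "y + dagger y"]
    by (simp add: S_def dagger_add algebra_simps)
  have emb: "H \<in> S" if "H \<in> K" for H
    using sdgD(1)[OF assms(1) that] sdgD(2)[OF assms(1) that that]
    by (simp only: S_def hermitian_def mem_Collect_eq)
  have "convex S"
    unfolding convex_alt
  proof (intro ballI allI impI)
    fix x y and u :: real
    assume "x \<in> S" "y \<in> S" "0 \<le> u \<and> u \<le> 1"
    \<comment> \<open>The endpoints are treated apart because \<open>S\<close> is closed only under
      strictly positive scaling.\<close>
    then show "(1 - u) *\<^sub>R x + u *\<^sub>R y \<in> S"
      using add scale by (cases "u = 0 \<or> u = 1") auto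
  qed
  moreover obtain k where k: "k \<in> S"
    using emb sdgD(5)[OF assms(1) psd_nonzero_rank_one[of "axis undefined 1"]]
    by (auto simp: axis_eq_0_iff)
  moreover have "G \<notin> S"
  proof
    assume "G \<in> S"
    then have "(1/2) *\<^sub>R (G + G) \<in> K"
      using assms(2) sdgD(3)[OF assms(1), of "G + G" "1/2"] by (simp add: S_def hermitian_def)
    then show False
      using assms(3) by (simp flip: scaleR_2)
  qed
  ultimately obtain a b where ab: "a \<noteq> 0" "inner a G \<le> b" "\<And>x. x \<in> S \<Longrightarrow> b \<le> inner a x"
    using separating_hyperplane_sets[of "{G}" S] by auto
  have nonneg: "0 \<le> inner a x" if "x \<in> S" for x
  proof (rule ccontr)
    assume neg: "\<not> 0 \<le> inner a x"
    \<comment> \<open>With this scaling \<open>inner a (c *\<^sub>R x)\<close> equals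
      \<open>- (\<bar>b\<bar> + 1)\<close>, which is below \<open>b\<close>.\<close>
    define c where "c = (\<bar>b\<bar> + 1) / - inner a x"
    have "b \<le> inner a (c *\<^sub>R x)"
      using neg that by (intro ab(3) scale) (auto simp: c_def divide_pos_neg)
    then show False
      using neg by (simp add: c_def)
  qed
  have "b \<le> 0"
  proof (rule ccontr)
    assume b: "\<not> b \<le> 0"
    \<comment> \<open>Shrinks \<open>k\<close> until its value drops below \<open>b\<close>; the
      added 1 guards against \<open>inner a k = 0\<close>.\<close>
    define c where "c = b / (2 * (inner a k + 1))"
    have k0: "0 \<le> inner a k"
      by (rule nonneg[OF k])
    have "b \<le> inner a (c *\<^sub>R k)"
      using b k0 k by (intro ab(3) scale) (auto simp: c_def)
    also have "\<dots> = b * (inner a k / (2 * (inner a k + 1)))"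
      by (simp add: c_def)
    also have "\<dots> < b * 1"
      using b k0 by (intro mult_strict_left_mono) (auto simp: divide_less_eq)
    finally show False
      by simp
  qed
  have anti: "inner a N = 0" if N: "dagger N = - N" for N
  proof (rule ccontr)
    assume nz: "inner a N \<noteq> 0"
    \<comment> \<open>Adding an anti-Hermitian matrix does not leave \<open>S\<close>, and this
      multiple brings the value at \<open>k\<close> down to -1.\<close>
    define c where "c = - (inner a k + 1) / inner a N"
    have "k + c *\<^sub>R N \<in> S"
      using k N by (simp add: S_def dagger_add dagger_scaleR algebra_simps)
    then show False
      using nonneg nz by (fastforce simp: inner_add_right c_def)
  qed
  have "dagger (a - dagger a) = - (a - dagger a)"
    by (simp add: dagger_diff dagger_dagger)
  then have "inner a (a - dagger a) = 0"
    by (rule anti)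
  \<comment> \<open>\<open>dagger\<close> preserves the inner product and negates
    \<open>a - dagger a\<close>; so \<open>a - dagger a\<close> is orthogonal to both
    \<open>a\<close> and \<open>dagger a\<close>, hence to itself.\<close>
  moreover have "inner (dagger a) (a - dagger a) = - inner a (a - dagger a)"
    using inner_dagger_dagger[of a "a - dagger a"]
    by (simp add: dagger_diff dagger_dagger inner_diff_right)
  ultimately have "inner (a - dagger a) (a - dagger a) = 0"
    by (simp only: inner_diff_left)
  then have herm: "hermitian a"
    by (simp add: hermitian_def)
  have K: "0 \<le> inner H a" if "H \<in> K" for H
    using nonneg[OF emb[OF that]] by (simp add: inner_commute)
  have "inner G ((1 / Re (trace a)) *\<^sub>R a) \<le> 0"
    using nonneg_functional_trace_pos[OF assms(1) K herm ab(1)] ab(2) \<open>b \<le> 0\<close>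
    by (simp add: inner_commute divide_nonpos_pos)
  then show thesis
    using that nonneg_functional_normalized_in_dual[OF assms(1) K herm ab(1)] by blast
qed

text \<open>Openness allows some \<open>D\<close> above \<open>e *\<^sub>R mat 1\<close> to be
  subtracted inside \<open>K\<close>; since \<open>\<rho>\<close> has trace one, \<open>D\<close>
  contributes at least \<open>e\<close> to the pairing.\<close>

lemma sdg_psd_or_inner_pos:
  assumes "sdg K" "\<rho> \<in> sdg_dual K" "G \<in> K"
  shows "psd_nonzero G \<or> 0 < inner G \<rho>"
proof (rule disjCI)
  assume "\<not> 0 < inner G \<rho>"
  show "psd_nonzero G"
  proof (rule ccontr)
    assume "\<not> psd_nonzero G"
    then obtain D where D: "pos_def D" "G - D \<in> K"
      using sdgD(6)[OF assms(1,3)] by blast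
    obtain e where e: "0 < e" "pos_semidef (D - e *\<^sub>R mat 1)"
      using pos_def_dominates_scaled_identity[OF D(1)] by blast
    have "0 \<le> inner (D - e *\<^sub>R mat 1) \<rho>"
      using sdg_nonneg_on_psd[OF assms(1) sdg_dual_nonneg[OF assms(2)] e(2)] .
    then have "e \<le> inner D \<rho>"
      using sdg_dual_trace[OF assms(2)] by (simp add: inner_diff_left inner_mat_1)
    moreover have "0 \<le> inner (G - D) \<rho>"
      using sdg_dual_nonneg[OF assms(2) D(2)] .
    ultimately show False
      using e(1) \<open>\<not> 0 < inner G \<rho>\<close> by (simp add: inner_diff_left)
  qed
qed

text \<open>The zero matrix is Hermitian and outside \<open>K\<close>, so separating it from
  \<open>K\<close> produces a dual element.\<close>

lemma sdg_dual_nonempty: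
  assumes "sdg K"
  obtains \<rho> where "\<rho> \<in> sdg_dual K"
  using exists_dual_separating[OF assms _ sdgD(4)[OF assms]]
  by (auto simp: hermitian_def dagger_def vec_eq_iff)

text \<open>A larger SDG has a nonempty dual inside \<open>{\<rho>}\<close>. A gamble it gained
  would pair positively with \<open>\<rho>\<close> by openness of \<open>K'\<close>, yet
  nonpositively by separation from \<open>K\<close>.\<close>

lemma maximal_sdg_if_singleton_dual:
  assumes "sdg K" "sdg_dual K = {\<rho>}"
  shows "maximal_sdg K"
  unfolding maximal_sdg_def
proof (intro conjI allI impI assms(1))
  fix K' assume K': "sdg K' \<and> K \<subseteq> K'"
  then obtain \<rho>' where "\<rho>' \<in> sdg_dual K'"
    using sdg_dual_nonempty by blast
  moreover have "sdg_dual K' \<subseteq> sdg_dual K"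
    using K' by (auto simp: sdg_dual_def)
  ultimately have \<rho>: "\<rho> \<in> sdg_dual K'"
    using assms(2) by auto
  have "G \<in> K" if "G \<in> K'" for G
  proof (rule ccontr)
    assume "G \<notin> K"
    then have "\<not> psd_nonzero G"
      using sdgD(5)[OF assms(1)] by blast
    then have "0 < inner G \<rho>"
      using sdg_psd_or_inner_pos[OF _ \<rho> that] K' by blast
    moreover have "inner G \<rho> \<le> 0"
      using exists_dual_separating[OF assms(1) _ \<open>G \<notin> K\<close>] sdgD(1) K' that assms(2)
      by (metis singletonD)
    ultimately show False by simp
  qed
  then show "K' = K"
    using K' by blast
qed

section \<open>Measurement projectors span the Hermitian matrices\<close>

text \<open>The hypothesis is orthonormality of the columns, which gives idempotence and
  orthogonality; completeness is \<open>U ** dagger U = mat 1\<close>, valid because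
  \<open>U\<close> is square.\<close>

lemma projection_measurement_of_unitary:
  assumes "dagger U ** U = (mat 1 :: 'k::finite cmat)"
  shows "projection_measurement (\<lambda>i. rank_one (column i U))"
proof -
  let ?P = "\<lambda>i. rank_one (column i U)"
  have orth: "(\<Sum>l\<in>UNIV. cnj (U $ l $ i) * U $ l $ j) = (if i = j then 1 else 0)" for i j
    using arg_cong[OF assms, of "\<lambda>M. M $ i $ j"]
    by (simp add: matrix_matrix_mult_def dagger_def mat_def)
  have prod: "?P i ** ?P j = (if i = j then ?P i else 0)" for i j
  proof -
    have "(?P i ** ?P j) $ r $ s
      = U $ r $ i * (\<Sum>l\<in>UNIV. cnj (U $ l $ i) * U $ l $ j) * cnj (U $ s $ j)" for r s
      by (simp add: rank_one_def column_def matrix_matrix_mult_def sum_distrib_left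
          sum_distrib_right mult.assoc)
    then show ?thesis
      by (simp add: orth vec_eq_iff rank_one_def column_def)
  qed
  have "?P i \<noteq> 0" for i
  proof
    assume "?P i = 0"
    then have "column i U = 0"
      by (simp only: rank_one_eq_0_iff)
    then have "\<And>l. U $ l $ i = 0"
      by (simp add: column_def vec_eq_iff)
    then show False
      using orth[of i i] by simp
  qed
  moreover have "(\<Sum>i\<in>UNIV. ?P i) = U ** dagger U"
    by (simp add: vec_eq_iff rank_one_def column_def matrix_matrix_mult_def dagger_def)
  then have "(\<Sum>i\<in>UNIV. ?P i) = mat 1"
    using assms matrix_left_right_inverse by metis
  ultimately show ?thesis
    by (simp add: projection_measurement_def hermitian_rank_one prod)
qed

text \<open>
  The columns of index \<open>j\<close> and \<open>k\<close> are \<open>(e\<^sub>j \<plusminus> z e\<^sub>k) / \<surd>2\<close>; together with the standard basis, the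
  choices \<open>z = 1\<close> and \<open>z = \<i>\<close> give enough projectors to span the Hermitian matrices.
\<close>

definition pair_unitary :: "'k \<Rightarrow> 'k \<Rightarrow> complex \<Rightarrow> 'k::finite cmat" where
  "pair_unitary j k z = (\<chi> r s.
     if s = j then (if r = j then 1 else if r = k then z else 0) / sqrt 2
     else if s = k then (if r = j then 1 else if r = k then - z else 0) / sqrt 2
     else if r = s then 1 else 0)"

text \<open>Outside rows and columns \<open>j\<close>, \<open>k\<close> the matrix is the identity,
  so everything reduces to a 2 by 2 block, whose columns are unit vectors because
  \<open>cmod z = 1\<close>.\<close>

lemma pair_unitary_unitary:
  assumes "j \<noteq> k" "cmod z = 1"
  shows "dagger (pair_unitary j k z) ** pair_unitary j k z = mat 1"
proof -
  let ?U = "pair_unitary j k z"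
  let ?c = "complex_of_real (1 / sqrt 2)"
  have zz: "z * cnj z = 1"
    using complex_norm_square[of z] assms(2) by simp
  have c: "?c * ?c = 1 / 2"
    by (simp only: flip: of_real_mult) simp
  have "(cnj z * ?c) * (z * ?c) = (z * cnj z) * (?c * ?c)"
    by (simp only: mult_ac)
  then have zc: "(cnj z * ?c) * (z * ?c) = 1 / 2"
    by (simp only: zz c mult_1_left)
  have U: "?U $ j $ j = ?c" "?U $ k $ j = z * ?c" "?U $ j $ k = ?c" "?U $ k $ k = - (z * ?c)"
    using assms(1) by (simp_all add: pair_unitary_def)
  have U0: "?U $ j $ t = 0" "?U $ k $ t = 0" if "t \<notin> {j, k}" for t
    using that by (auto simp: pair_unitary_def)
  have zero: "?U $ l $ j = 0" "?U $ l $ k = 0" if "l \<notin> {j, k}" for l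
    using that by (auto simp: pair_unitary_def)
  have split: "(\<Sum>l\<in>UNIV. f l) = f j + f k + (\<Sum>l\<in>UNIV - {j, k}. f l)" for f :: "_ \<Rightarrow> complex"
  proof -
    have "(\<Sum>l\<in>UNIV. f l) = (\<Sum>l\<in>{j, k}. f l) + (\<Sum>l\<in>UNIV - {j, k}. f l)"
      using sum.subset_diff[of "{j, k}" UNIV f] by (simp only: add.commute finite subset_UNIV)
    then show ?thesis using assms(1) by simp
  qed
  have "(\<Sum>l\<in>UNIV. cnj (?U $ l $ r) * ?U $ l $ s) = (if r = s then 1 else 0)" for r s
  proof (cases "r \<in> {j, k} \<or> s \<in> {j, k}")
    case True
    have "(\<Sum>l\<in>UNIV - {j, k}. cnj (?U $ l $ r) * ?U $ l $ s) = 0"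
      using True zero by (intro sum.neutral) auto
    then have "(\<Sum>l\<in>UNIV. cnj (?U $ l $ r) * ?U $ l $ s)
      = cnj (?U $ j $ r) * ?U $ j $ s + cnj (?U $ k $ r) * ?U $ k $ s"
      by (simp only: split add_0_right)
    also have "\<dots> = (if r = s then 1 else 0)"
    proof -
      \<comment> \<open>Either both columns belong to the block, or one of them lies outside and
        vanishes in rows \<open>j\<close> and \<open>k\<close>.\<close>
      consider "r \<in> {j, k}" "s \<in> {j, k}" | "r \<notin> {j, k}" "r \<noteq> s" | "s \<notin> {j, k}" "r \<noteq> s"
        using True by blast
      then show ?thesis
      proof cases
        case 1
        then show ?thesis
          using assms(1) c zc
          by (elim insertE emptyE)
            (simp_all only: U complex_cnj_mult complex_cnj_minus complex_cnj_complex_of_real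
              mult_minus_left mult_minus_right minus_minus, simp_all)
      qed (simp_all add: U0)
    qed
    finally show ?thesis .
  next
    case False
    then have "cnj (?U $ l $ r) * ?U $ l $ s = (if l = r then if r = s then 1 else 0 else 0)" for l
      by (simp add: pair_unitary_def)
    then show ?thesis
      by simp
  qed
  then show ?thesis
    by (simp add: vec_eq_iff matrix_matrix_mult_def dagger_def mat_def)
qed

text \<open>Polarisation: the standard basis kills the diagonal, and the pair vectors then give
  \<open>Re (z * Y $ j $ k) = 0\<close>, where \<open>z = 1\<close> and \<open>z = \<i>\<close>
  yield real and imaginary part.\<close>

lemma hermitian_zero_if_orthogonal_to_measurements:
  assumes "hermitian (Y :: 'k::finite cmat)"
    and zero: "\<And>P i. projection_measurement P \<Longrightarrow> inner (P i) Y = 0"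
  shows "Y = 0"
proof -
  have herm: "cnj (Y $ i $ j) = Y $ j $ i" for i j
    using assms(1) by (simp add: hermitian_iff)
  have q: "quad_form Y (column i U) = 0" if "dagger U ** U = mat 1" for i U
    using zero[OF projection_measurement_of_unitary[OF that]] by (simp add: inner_rank_one)
  have diag: "Y $ j $ j = 0" for j
  proof -
    have "Re (Y $ j $ j) = 0"
      using q[of "mat 1" j, unfolded hermitian_mat_1[unfolded hermitian_def] matrix_mul_lid, OF refl]
      by (simp add: quad_form_def column_def mat_def
          matrix_vector_mult_def if_distrib if_distribR cong: if_cong)
    then show ?thesis
      using herm[of j j] by (simp add: complex_eq_iff)
  qed
  have off: "Re (z * Y $ j $ k) = 0" if "j \<noteq> k" "cmod z = 1" for j k z
  proof -
    let ?u = "column j (pair_unitary j k z)"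
    have split: "(\<Sum>l\<in>UNIV. f l) = f j + f k" if "\<And>l. l \<noteq> j \<Longrightarrow> l \<noteq> k \<Longrightarrow> f l = 0"
      for f :: "_ \<Rightarrow> complex"
      using sum.mono_neutral_right[of UNIV "{j, k}" f] that \<open>j \<noteq> k\<close> by auto
    have u: "?u $ l = 0" if "l \<noteq> j" "l \<noteq> k" for l
      using that by (simp add: column_def pair_unitary_def)
    \<comment> \<open>Since the diagonal of \<open>Y\<close> vanishes, only the two cross terms
      survive; they are conjugate to each other.\<close>
    have "(\<Sum>i\<in>UNIV. cnj (?u $ i) * (Y *v ?u) $ i)
      = cnj (?u $ j) * (Y $ j $ k * ?u $ k) + cnj (?u $ k) * (Y $ k $ j * ?u $ j)"
      by (simp add: split u matrix_vector_mult_def diag)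
    also have "\<dots> = (z * Y $ j $ k + cnj (z * Y $ j $ k)) / (complex_of_real (sqrt 2) * sqrt 2)"
      using that(1) by (simp add: column_def pair_unitary_def herm add_divide_distrib mult.commute)
    also have "\<dots> = of_real (Re (z * Y $ j $ k))"
      by (subst complex_add_cnj) (simp add: complex_eq_iff flip: of_real_mult)
    finally have "quad_form Y ?u = Re (z * Y $ j $ k)"
      by (simp only: quad_form_def Re_complex_of_real)
    then show ?thesis
      using q[OF pair_unitary_unitary[OF that], of j] by simp
  qed
  have "Y $ j $ k = 0" for j k
    using diag off[of j k 1] off[of j k \<i>] by (cases "j = k") (auto simp: complex_eq_iff)
  then show ?thesis
    by (simp add: vec_eq_iff)
qed

section \<open>Kronecker products and partial traces\<close>

lemma hermitian_kron: "hermitian G \<Longrightarrow> hermitian H \<Longrightarrow> hermitian (G \<otimes> H)"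
  by (simp add: hermitian_iff kron_def)

lemma kron_mult: "(A \<otimes> B) ** (C \<otimes> D) = (A ** C) \<otimes> (B ** D)"
proof -
  have "(\<Sum>p\<in>UNIV. f (fst p) * g (snd p)) = (\<Sum>a\<in>UNIV. f a) * (\<Sum>b\<in>UNIV. g b)"
    for f :: "'a \<Rightarrow> complex" and g :: "'b \<Rightarrow> complex"
    by (simp add: sum_product sum.cartesian_product case_prod_beta flip: UNIV_Times_UNIV)
  note * = this
  show ?thesis
    by (simp add: vec_eq_iff kron_def matrix_matrix_mult_def mult.left_commute mult.assoc
        flip: *)
qed

text \<open>\<open>contract_B \<tau> H\<close> is \<open>Tr\<^sub>B((I \<otimes> H) \<tau>)\<close>, and \<open>contract_A \<tau> G\<close> is \<open>Tr\<^sub>A((G \<otimes> I) \<tau>)\<close>.\<close>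

definition contract_B :: "('a::finite \<times> 'b::finite) cmat \<Rightarrow> 'b cmat \<Rightarrow> 'a cmat" where
  "contract_B \<tau> H = (\<chi> a a'. \<Sum>b\<in>UNIV. \<Sum>b'\<in>UNIV. H $ b' $ b * \<tau> $ (a, b) $ (a', b'))"

definition contract_A :: "('a::finite \<times> 'b::finite) cmat \<Rightarrow> 'a cmat \<Rightarrow> 'b cmat" where
  "contract_A \<tau> G = (\<chi> b b'. \<Sum>a\<in>UNIV. \<Sum>a'\<in>UNIV. G $ a' $ a * \<tau> $ (a, b) $ (a', b'))"

lemma hermitian_contract_B:
  assumes "hermitian \<tau>" "hermitian H"
  shows "hermitian (contract_B \<tau> H)"
  using assms unfolding hermitian_iff contract_B_def by (auto intro: sum.swap)

lemma hermitian_contract_A: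
  assumes "hermitian \<tau>" "hermitian G"
  shows "hermitian (contract_A \<tau> G)"
  using assms unfolding hermitian_iff contract_A_def by (auto intro: sum.swap)

lemma sum_UNIV_prod: "(\<Sum>p\<in>UNIV. f p) = (\<Sum>a\<in>UNIV. \<Sum>b\<in>UNIV. f (a, b))"
  for f :: "'a::finite \<times> 'b::finite \<Rightarrow> 'c::comm_monoid_add"
  by (simp add: sum.cartesian_product)

lemma inner_kron:
  "inner (G \<otimes> H) \<tau> = Re (\<Sum>a\<in>UNIV. \<Sum>b\<in>UNIV. \<Sum>a'\<in>UNIV. \<Sum>b'\<in>UNIV.
      cnj (G $ a $ a') * cnj (H $ b $ b') * \<tau> $ (a, b) $ (a', b'))"
  by (simp only: inner_cmat Re_sum sum_UNIV_prod kron_def vec_lambda_beta fst_conv snd_conv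
      complex_cnj_mult)

text \<open>Contraction is adjoint to tensoring with \<open>H\<close>; it turns a functional on the
  composite system into one on \<open>A\<close>.\<close>

lemma inner_kron_contract_B:
  assumes "hermitian H"
  shows "inner (G \<otimes> H) \<tau> = inner G (contract_B \<tau> H)"
proof -
  have H: "cnj (H $ b $ b') = H $ b' $ b" for b b'
    using assms by (simp add: hermitian_iff)
  have "(\<Sum>a\<in>UNIV. \<Sum>b\<in>UNIV. \<Sum>a'\<in>UNIV. \<Sum>b'\<in>UNIV.
      cnj (G $ a $ a') * cnj (H $ b $ b') * \<tau> $ (a, b) $ (a', b'))
    = (\<Sum>a\<in>UNIV. \<Sum>a'\<in>UNIV. \<Sum>b\<in>UNIV. \<Sum>b'\<in>UNIV.
      cnj (G $ a $ a') * cnj (H $ b $ b') * \<tau> $ (a, b) $ (a', b'))"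
    by (intro sum.cong refl sum.swap)
  also have "\<dots> = (\<Sum>a\<in>UNIV. \<Sum>a'\<in>UNIV. cnj (G $ a $ a') * contract_B \<tau> H $ a $ a')"
    by (simp add: contract_B_def sum_distrib_left H mult.assoc)
  finally show ?thesis
    by (simp only: inner_kron inner_cmat[of G] flip: Re_sum)
qed

lemma inner_kron_contract_A:
  assumes "hermitian G"
  shows "inner (G \<otimes> H) \<tau> = inner H (contract_A \<tau> G)"
proof -
  have G: "cnj (G $ a $ a') = G $ a' $ a" for a a'
    using assms by (simp add: hermitian_iff)
  have "(\<Sum>a\<in>UNIV. \<Sum>b\<in>UNIV. \<Sum>a'\<in>UNIV. \<Sum>b'\<in>UNIV.
      cnj (G $ a $ a') * cnj (H $ b $ b') * \<tau> $ (a, b) $ (a', b'))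
    = (\<Sum>b\<in>UNIV. \<Sum>a\<in>UNIV. \<Sum>b'\<in>UNIV. \<Sum>a'\<in>UNIV.
      cnj (G $ a $ a') * cnj (H $ b $ b') * \<tau> $ (a, b) $ (a', b'))"
    by (subst sum.swap) (intro sum.cong refl sum.swap)
  also have "\<dots> = (\<Sum>b\<in>UNIV. \<Sum>b'\<in>UNIV. \<Sum>a\<in>UNIV. \<Sum>a'\<in>UNIV.
      cnj (G $ a $ a') * cnj (H $ b $ b') * \<tau> $ (a, b) $ (a', b'))"
    by (intro sum.cong refl sum.swap)
  also have "\<dots> = (\<Sum>b\<in>UNIV. \<Sum>b'\<in>UNIV. cnj (H $ b $ b') * contract_A \<tau> G $ b $ b')"
    by (simp add: contract_A_def sum_distrib_left G mult_ac)
  finally show ?thesis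
    by (simp only: inner_kron inner_cmat[of H] flip: Re_sum)
qed

text \<open>The complex traces multiply; each is real for Hermitian factors, so the real part of the
  product splits.\<close>

lemma inner_kron_kron:
  assumes "hermitian G" "hermitian H" "hermitian R" "hermitian S"
  shows "inner (G \<otimes> H) (R \<otimes> S) = inner G R * inner H S"
proof -
  have im: "Im (trace (dagger G ** R)) = 0" if "hermitian G" "hermitian R"
    for G R :: "'k::finite cmat"
    using trace_dagger_mult_real[OF that] complex_is_Real_iff by blast
  have tr: "trace (dagger G ** R) = (\<Sum>i\<in>UNIV. \<Sum>j\<in>UNIV. cnj (G $ i $ j) * R $ i $ j)"
    for G R :: "'k::finite cmat"
    by (simp add: trace_def matrix_matrix_mult_def dagger_def) (rule sum.swap)
  have "(\<Sum>a\<in>UNIV. \<Sum>b\<in>UNIV. \<Sum>a'\<in>UNIV. \<Sum>b'\<in>UNIV.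
      cnj (G $ a $ a') * cnj (H $ b $ b') * (R \<otimes> S) $ (a, b) $ (a', b'))
    = trace (dagger G ** R) * trace (dagger H ** S)"
    by (simp add: tr kron_def sum_product mult_ac)
  then have "inner (G \<otimes> H) (R \<otimes> S) = Re (trace (dagger G ** R) * trace (dagger H ** S))"
    by (simp only: inner_kron)
  then show ?thesis
    using im[OF assms(1,3)] im[OF assms(2,4)]
    by (simp add: mat_inner_def flip: mat_inner_eq_inner)
qed

text \<open>As \<open>Q\<close> is self-adjoint, the new quadratic form at \<open>x\<close> is that
  of \<open>G\<close> at \<open>Q *v x\<close>.\<close>

lemma pos_semidef_conjugate:
  assumes "pos_semidef G" "hermitian Q"
  shows "pos_semidef (Q ** G ** Q)"
proof -
  have adj: "inner x (Q *v y) = inner (Q *v x) y" for x y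
  proof -
    have "(\<Sum>i\<in>UNIV. cnj (x $ i) * (Q *v y) $ i)
      = (\<Sum>i\<in>UNIV. \<Sum>j\<in>UNIV. cnj (Q $ j $ i * x $ i) * y $ j)"
      using assms(2) by (simp add: hermitian_iff matrix_vector_mult_def sum_distrib_left mult_ac)
    also have "\<dots> = (\<Sum>j\<in>UNIV. cnj ((Q *v x) $ j) * y $ j)"
      by (subst sum.swap) (simp add: matrix_vector_mult_def sum_distrib_right)
    finally show ?thesis
      by (simp only: inner_vec_def inner_complex_eq_Re flip: Re_sum)
  qed
  have dm: "dagger (A ** B) = dagger B ** dagger A" for A B :: "'a cmat"
    by (simp add: dagger_def matrix_matrix_mult_def vec_eq_iff mult.commute)
  have "hermitian (Q ** G ** Q)"
    using assms by (simp add: pos_semidef_def hermitian_def dm matrix_mul_assoc)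
  moreover have "quad_form (Q ** G ** Q) x = quad_form G (Q *v x)" for x
    by (simp add: quad_form_eq_inner adj flip: matrix_vector_mul_assoc)
  ultimately show ?thesis
    using assms(1) by (simp add: pos_semidef_def)
qed

section \<open>From irrelevance to the product state\<close>

text \<open>Sandwiching turns \<open>G \<otimes> mat 1\<close> into \<open>G \<otimes> P i\<close>.
  By irrelevance either this matrix lies in \<open>K\<close>, or \<open>G \<otimes> mat 1\<close> is
  positive semi-definite and conjugation preserves that.\<close>

lemma irrelevance_conditional_nonneg:
  fixes K :: "('a::finite \<times> 'b::finite) cmat set"
  assumes "sdg K" "irrelevance_A_to_B K" "projection_measurement P" "\<tau> \<in> sdg_dual K"
    and "G \<in> marg_A K"
  shows "0 \<le> inner (G \<otimes> P i) \<tau>"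
proof -
  let ?Q = "mat 1 \<otimes> P i"
  have P: "hermitian (P i)" "P i ** P i = P i"
    using assms(3) by (auto simp: projection_measurement_def)
  have eq: "?Q ** (G \<otimes> mat 1) ** ?Q = G \<otimes> P i"
    by (simp add: kron_mult P(2))
  have "G \<in> marg_A (cond_B K (P i))"
    using assms(2,3,5) unfolding irrelevance_A_to_B_def by blast
  then have "psd_nonzero (G \<otimes> (mat 1 :: 'b cmat)) \<or> G \<otimes> P i \<in> K"
    by (auto simp: marg_A_def cond_B_def eq)
  then show ?thesis
  proof
    assume "psd_nonzero (G \<otimes> (mat 1 :: 'b cmat))"
    then have "pos_semidef (G \<otimes> P i)"
      using pos_semidef_conjugate[of "G \<otimes> mat 1" ?Q] eq P(1)
      by (simp add: psd_nonzero_def hermitian_kron hermitian_mat_1)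
    then show ?thesis
      using sdg_nonneg_on_psd[OF assms(1) sdg_dual_nonneg[OF assms(4)]] by blast
  qed (rule sdg_dual_nonneg[OF assms(4)])
qed

text \<open>Contraction is complex linear in \<open>G\<close> and every matrix is
  \<open>G + \<i> H\<close> with Hermitian \<open>G\<close>, \<open>H\<close>; matrix units then
  read off the entries of \<open>Z\<close>.\<close>

lemma contract_A_hermitian_zero:
  assumes "\<And>G. hermitian G \<Longrightarrow> contract_A Z G = 0"
  shows "Z = 0"
proof -
  have lin: "contract_A Z (\<chi> r s. G $ r $ s + \<i> * H $ r $ s) $ b $ b'
    = contract_A Z G $ b $ b' + \<i> * contract_A Z H $ b $ b'" for G H b b'
    by (simp add: contract_A_def sum_distrib_left algebra_simps sum.distrib)
  have "contract_A Z M = 0" for M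
  proof -
    define G where "G = (1/2) *\<^sub>R (M + dagger M)"
    define H :: "'a cmat" where "H = (\<chi> r s. - \<i> * (M $ r $ s - cnj (M $ s $ r)) / 2)"
    have "hermitian G" "hermitian H"
      by (auto simp: hermitian_iff G_def H_def dagger_def algebra_simps complex_eq_iff)
    moreover have "M = (\<chi> r s. G $ r $ s + \<i> * H $ r $ s)"
      by (simp add: G_def H_def dagger_def vec_eq_iff complex_eq_iff field_simps)
    moreover have "contract_A Z (\<chi> r s. G $ r $ s + \<i> * H $ r $ s) $ b $ b' = 0" for b b'
      using lin[of G H] \<open>hermitian G\<close> \<open>hermitian H\<close> by (simp add: assms)
    then have "contract_A Z (\<chi> r s. G $ r $ s + \<i> * H $ r $ s) = 0"
      by (simp only: vec_eq_iff zero_index simp_thms)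
    ultimately show ?thesis
      by (simp only:)
  qed
  note all = this
  have "Z $ (a, b) $ (a', b') = 0" for a b a' b'
  proof -
    \<comment> \<open>The unit sits at position \<open>(a', a)\<close> because
      \<open>contract_A\<close> pairs the transposed indices.\<close>
    define M :: "'a cmat" where "M = (\<chi> r s. if r = a' then if s = a then 1 else 0 else 0)"
    have "M $ r $ s * w = (if r = a' then if s = a then w else 0 else 0)" for r s w
      by (simp add: M_def)
    then have "contract_A Z M $ b $ b' = Z $ (a, b) $ (a', b')"
      by (simp add: contract_A_def)
    then show ?thesis
      using all[of M] by simp
  qed
  then show ?thesis
    by (simp add: vec_eq_iff)
qed

lemma kron_mat_1_mat_1: "mat 1 \<otimes> mat 1 = mat 1"
  by (auto simp: kron_def mat_def vec_eq_iff prod_eq_iff)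

text \<open>The partial trace of \<open>\<tau>\<close> over \<open>A\<close> is nonnegative on
  \<open>marg_B K\<close> by definition of the marginal, hence a multiple of \<open>\<rho>\<close>;
  the factor is the trace of \<open>\<tau>\<close>, which is 1.\<close>

lemma inner_mat_1_kron_dual:
  assumes "sdg (marg_B K)" "sdg_dual (marg_B K) = {\<rho>}" "\<tau> \<in> sdg_dual K" "hermitian H"
  shows "inner (mat 1 \<otimes> H) \<tau> = inner H \<rho>"
proof -
  let ?\<sigma> = "contract_A \<tau> (mat 1)"
  note ic = inner_kron_contract_A[OF hermitian_mat_1, where \<tau> = \<tau>]
  have "0 \<le> inner G ?\<sigma>" if "G \<in> marg_B K" for G
    using sdg_dual_nonneg[OF assms(3), of "mat 1 \<otimes> G"] that by (simp add: ic marg_B_def)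
  then have "?\<sigma> = Re (trace ?\<sigma>) *\<^sub>R \<rho>"
    using nonneg_functional_multiple_of_dual[OF assms(1,2)]
      hermitian_contract_A[OF sdg_dual_hermitian[OF assms(3)] hermitian_mat_1] by blast
  moreover have "Re (trace ?\<sigma>) = 1"
    using ic[of "mat 1"] sdg_dual_trace[OF assms(3)] by (simp add: inner_mat_1 kron_mat_1_mat_1)
  ultimately show ?thesis
    by (simp add: ic)
qed

text \<open>\<open>contract_B \<tau> (P i)\<close> is the unnormalised state of \<open>A\<close>
  after outcome \<open>i\<close>. Irrelevance makes it proportional to \<open>\<rho>\<close>, and
  its trace is the probability of the outcome.\<close>

lemma inner_kron_projector_dual:
  assumes "sdg K" "irrelevance_A_to_B K" "sdg (marg_A K)" "sdg_dual (marg_A K) = {\<rho>}"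
    and "\<tau> \<in> sdg_dual K" "projection_measurement P"
  shows "inner (G \<otimes> P i) \<tau> = inner (mat 1 \<otimes> P i) \<tau> * inner G \<rho>"
proof -
  have P: "hermitian (P i)"
    using assms(6) by (simp add: projection_measurement_def)
  let ?\<sigma> = "contract_B \<tau> (P i)"
  note ic = inner_kron_contract_B[OF P, where \<tau> = \<tau>]
  have "0 \<le> inner H ?\<sigma>" if "H \<in> marg_A K" for H
    using irrelevance_conditional_nonneg[OF assms(1,2,6,5) that, of i] by (simp add: ic)
  then have "?\<sigma> = Re (trace ?\<sigma>) *\<^sub>R \<rho>"
    using nonneg_functional_multiple_of_dual[OF assms(3,4)]
      hermitian_contract_B[OF sdg_dual_hermitian[OF assms(5)] P] by blast
  then have "inner G ?\<sigma> = Re (trace ?\<sigma>) * inner G \<rho>"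
    by (metis inner_scaleR_right)
  then show ?thesis
    by (simp add: ic inner_mat_1)
qed

text \<open>Two stages: for fixed \<open>G\<close> the projectors determine the contraction of the
  difference, and then varying \<open>G\<close> determines the difference itself.\<close>

lemma eq_if_inner_kron_projector_eq:
  assumes "hermitian \<tau>" "hermitian \<tau>'"
    and eq: "\<And>G P i. hermitian G \<Longrightarrow> projection_measurement P \<Longrightarrow>
      inner (G \<otimes> P i) \<tau> = inner (G \<otimes> P i) \<tau>'"
  shows "\<tau> = \<tau>'"
proof -
  have "contract_A (\<tau> - \<tau>') G = 0" if G: "hermitian G" for G
  proof (rule hermitian_zero_if_orthogonal_to_measurements)
    show "hermitian (contract_A (\<tau> - \<tau>') G)"
      using assms(1,2) G by (intro hermitian_contract_A hermitian_diff)
    show "inner (P i) (contract_A (\<tau> - \<tau>') G) = 0" if "projection_measurement P" for P i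
      using eq[OF G that] by (simp add: inner_diff_right flip: inner_kron_contract_A[OF G])
  qed
  then have "\<tau> - \<tau>' = 0"
    by (rule contract_A_hermitian_zero)
  then show ?thesis
    by simp
qed

lemma dual_of_independent_product:
  assumes "sdg K" "irrelevance_A_to_B K"
    and "sdg (marg_A K)" "sdg_dual (marg_A K) = {\<rho>A}"
    and "sdg (marg_B K)" "sdg_dual (marg_B K) = {\<rho>B}"
    and "\<tau> \<in> sdg_dual K"
  shows "\<tau> = \<rho>A \<otimes> \<rho>B"
proof -
  have hA: "hermitian \<rho>A" and hB: "hermitian \<rho>B"
    using sdg_dual_hermitian assms(4,6) by blast+
  have "inner (G \<otimes> P i) \<tau> = inner (G \<otimes> P i) (\<rho>A \<otimes> \<rho>B)"
    if G: "hermitian G" and P: "projection_measurement P" for G P i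
  proof -
    have Pi: "hermitian (P i)"
      using P by (simp add: projection_measurement_def)
    show ?thesis
      using inner_kron_projector_dual[OF assms(1-4,7) P, of G i]
        inner_mat_1_kron_dual[OF assms(5-7) Pi]
      by (simp add: inner_kron_kron[OF G Pi hA hB])
  qed
  then show ?thesis
    by (rule eq_if_inner_kron_projector_eq[OF sdg_dual_hermitian[OF assms(7)] hermitian_kron[OF hA hB]])
qed

theorem propositionA15:
  fixes K :: "('a::finite \<times> 'b::finite) cmat set"
    and \<rho>A :: "'a cmat" and \<rho>B :: "'b cmat"
  assumes "sdg K"
    and "epistemic_independence K"
    and "maximal_sdg (marg_A K)" and "sdg_dual (marg_A K) = {\<rho>A}"
    and "maximal_sdg (marg_B K)" and "sdg_dual (marg_B K) = {\<rho>B}"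
    and "\<And>P i. projection_measurement P \<Longrightarrow> 0 < Re (trace (P i ** \<rho>A ** P i))"
    and "\<And>P i. projection_measurement P \<Longrightarrow> 0 < Re (trace (P i ** \<rho>B ** P i))"
  shows "sdg_dual K = {\<rho>A \<otimes> \<rho>B} \<and> maximal_sdg K"
proof -
  have "irrelevance_A_to_B K" "sdg (marg_A K)" "sdg (marg_B K)"
    using assms(2,3,5) by (auto simp: epistemic_independence_def maximal_sdg_def)
  then have "\<tau> = \<rho>A \<otimes> \<rho>B" if "\<tau> \<in> sdg_dual K" for \<tau>
    using dual_of_independent_product assms(1,4,6) that by blast
  \<comment> \<open>Uniqueness alone gives one inclusion; nonemptiness of the dual supplies the
    other.\<close>
  then have "sdg_dual K = {\<rho>A \<otimes> \<rho>B}"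
    using sdg_dual_nonempty[OF assms(1)] by blast
  then show ?thesis
    using maximal_sdg_if_singleton_dual[OF assms(1)] by blast
qed

end
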